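(* Assume: (1) the equilibrium $\bm{0}$ is uniformly locally exponentially stable (in the sense given in the context); (2) $B(\bm{0},R)=\{\bm{x}\in\mathbb{R}^n\mid h_0(\bm{x})\le R\}$ with $h_0(\bm{x})=\sum_{i=1}^n x_i^2$ and $R>0$ a constant such that $\Omega(X)\subset B(\bm{0},R)$, where $\Omega(X)=\{\bm{x}\in\mathbb{R}^n\mid \bm{x}=\bm{f}(\bm{x}_0,\bm{d}),\ \bm{x}_0\in X,\ \bm{d}\in D\}\cup X$; and $X_{\infty}=\{\bm{x}\in\mathbb{R}^n\mid h_{\infty}(\bm{x})<1\}$, with $h_{\infty}\in\mathbb{R}[\bm{x}]$, is a robust region of attraction with $\bm{0}\in X_{\infty}^{\circ}$; (3) one of the polynomials $h_i^D$ defining $D$ equals $\|\bm{d}\|^2-R_D$ for some constant $R_D\ge0$. Let $(u_{k_i})_{i=0}^{\infty}$ be a sequence such that each $u_{k_i}\in\mathbb{R}_{k_i}[\bm{x}]$ is the $u$-component of a solution to the sum-of-squares program (SOS) with $k=k_i$ given in the context, and such that $u_{k_i}$ converges from above to $v$ uniformly over $B(\bm{0},R)$ as $i\to\infty$, where $v$ is the continuous and bounded solution to the Bellman equation given in the context. Then the sets $\mathcal{R}_{k_i}=\{\bm{x}\in B(\bm{0},R)\mid u_{k_i}(\bm{x})<1\}$ satisfy $$\mathcal{R}_{k_i}\subset\mathcal{R}^{\circ}\quad\text{and}\quad \lim_{i\to\infty}\mu(\mathcal{R}^{\circ}\setminus\mathcal{R}_{k_i})=0.$$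
   Context: $\mathbb{N}$ is the set of non-negative integers, $\|\cdot\|$ the Euclidean norm, $B(\bm{0},r)=\{\bm{x}\in\mathbb{R}^n\mid \|\bm{x}\|^2\le r\}$ for $r>0$; $\mathbb{R}_k[\bm{x}]$ is the space of real polynomials in $\bm{x}$ of total degree $\le k$; $\Delta^\circ$ is the interior of $\Delta$; $\mu$ is Lebesgue measure on $\mathbb{R}^n$. "Converges from above" means $u_{k_i}\ge v$ on $B(\bm{0},R)$ for all $i$. System: $\bm{x}(k+1)=\bm{f}(\bm{x}(k),\bm{d}(k))$, $k\in\mathbb{N}$, where $\bm{f}$ is an $\mathbb{R}^n$-valued map with components in $\mathbb{R}[\bm{x},\bm{d}]$ ($\bm{x}\in\mathbb{R}^n$, $\bm{d}\in\mathbb{R}^m$), $D=\{\bm{d}\in\mathbb{R}^m\mid h_i^D(\bm{d})\le 0,\ i=1,\ldots,m_d\}$ is compact with $h_i^D\in\mathbb{R}[\bm{d}]$, and $\bm{f}(\bm{0},\bm{d})=\bm{0}$ for all $\bm{d}\in D$. A perturbation input policy is a function $\pi:\mathbb{N}\to D$; $\mathcal{D}$ is the set of all of them. The trajectory from $\bm{x}_0$ under $\pi$ is $\bm{\phi}_{\bm{x}_0}^{\pi}(0)=\bm{x}_0$, $\bm{\phi}_{\bm{x}_0}^{\pi}(k+1)=\bm{f}(\bm{\phi}_{\bm{x}_0}^{\pi}(k),\pi(k))$. State constraint set: $X=\{\bm{x}\in\mathbb{R}^n\mid h_i^X(\bm{x})<1,\ i=1,\ldots,n_X\}$ is bounded and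 open, with $h_i^X\in\mathbb{R}[\bm{x}]$, $h_i^X(\bm{x})>0$ for $\bm{x}\ne\bm{0}$ and $h_i^X(\bm{0})=0$. Uniform local exponential stability: there exist constants $M>0$, $r>0$, $0<\lambda<1$ with $B(\bm{0},r)\subset X$ and $\|\bm{\phi}_{\bm{x}_0}^{\pi}(k)\|\le\lambda^kM\|\bm{x}_0\|$ for all $\bm{x}_0\in B(\bm{0},r)$, $\pi\in\mathcal{D}$, $k\in\mathbb{N}$. Maximal robust region of attraction: $\mathcal{R}=\{\bm{x}_0\mid \bm{\phi}_{\bm{x}_0}^{\pi}(k)\in X\ \forall k\in\mathbb{N},\forall\pi\in\mathcal{D},\ \text{and}\ \lim_{k\to\infty}\bm{\phi}_{\bm{x}_0}^{\pi}(k)=\bm{0}\ \forall\pi\in\mathcal{D}\}$. A robust region of attraction is any subset of $\mathcal{R}$. $g\in\mathbb{R}[\bm{x}]$ is a fixed non-negative polynomial with $g(\bm{x})=0$ iff $\bm{x}=\bm{0}$; $l(x)=x$ for $x\ge0$ and $l(x)=0$ otherwise. $v:\mathbb{R}^n\to[0,1]$ is the unique bounded and continuous solution to $$\min\Big\{\inf_{\bm{d}\in D}\{v(\bm{x})-v(\bm{f}(\bm{x},\bm{d}))-g(\bm{x})(1-v(\bm{x}))\},\ v(\bm{x})-1+\min_{1\le j\le n_X} l(1-h_j^X(\bm{x}))\Big\}=0\ \ \forall\bm{x}\in\mathbb{R}^n,\qquad v(\bm{0})=0,$$ and it satisfies $\mathcal{R}^{\circ}=\{\bm{x}\in\mathbb{R}^n\mid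 v(\bm{x})<1\}$. Program (SOS): minimize $\int_{B(\bm{0},R)}u\,d\bm{x}-\int_{X_\infty}u\,d\bm{x}$ over $u\in\mathbb{R}_k[\bm{x}]$ and sum-of-squares polynomials $s_0,s_1,s_2,s_{3,i}\in\mathbb{R}[\bm{x},\bm{d}]$ ($i=1,\ldots,m_d$) and $s_{4,j},\ldots,s_{8,j},s_{9,l,j}\in\mathbb{R}[\bm{x}]$ ($j,l=1,\ldots,n_X$), subject to the polynomial identities, for $j=1,\ldots,n_X$, $$u(\bm{x})-u(\bm{f}(\bm{x},\bm{d}))-g(\bm{x})(1-u(\bm{x}))=s_0+s_1(R-h_0)+s_2(h_\infty-1)-\sum_{i=1}^{m_d}s_{3,i}h_i^D,$$ $$u-1=s_{4,j}+s_{5,j}(R-h_0)+s_{6,j}(h_j^X-1),$$ $$u-h_j^X=s_{7,j}+s_{8,j}(R-h_0)+\sum_{l=1}^{n_X}s_{9,l,j}(1-h_l^X).$$ A solution to (SOS) means a feasible tuple: $u\in\mathbb{R}_k[\bm{x}]$ together with sum-of-squares polynomials $s_0,s_1,s_2,s_{3,i}\in\mathbb{R}[\bm{x},\bm{d}]$ ($i=1,\ldots,m_d$) and $s_{4,j},\ldots,s_{8,j},s_{9,l,j}\in\mathbb{R}[\bm{x}]$ ($j,l=1,\ldots,n_X$) for which all these identities hold. *)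

theory Defs
  imports "HOL-Analysis.Analysis"
begin

(* Real polynomials are represented by the functions they induce: R[x] and R[x,d] are the
   real_polynomial_functions on real^'n and on (real^'n) \<times> (real^'m).  Over the infinite field of reals
   this is an isomorphism of rings, so polynomial identities are pointwise identities. *)

definition polys_upto :: "nat \<Rightarrow> (real^'n \<Rightarrow> real) set" where
  "polys_upto k = {p. \<exists>c. \<forall>x. p x =
     (\<Sum>\<alpha> | (\<Sum>i\<in>UNIV. \<alpha> i) \<le> k. c (\<alpha> :: 'n \<Rightarrow> nat) * (\<Prod>i\<in>UNIV. x $ i ^ \<alpha> i))}"

definition sos :: "('a::real_normed_vector \<Rightarrow> real) \<Rightarrow> bool" where
  "sos p \<longleftrightarrow> (\<exists>(N::nat) q. (\<forall>i<N. real_polynomial_function (q i)) \<and> (\<forall>x. p x = (\<Sum>i<N. (q i x)\<^sup>2)))"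

(* The radius bounds the squared norm. *)
definition sqball :: "real \<Rightarrow> (real^'n) set" where
  "sqball r = {x. (norm x)\<^sup>2 \<le> r}"

definition h0 :: "real^'n \<Rightarrow> real" where
  "h0 x = (\<Sum>i\<in>UNIV. (x $ i)\<^sup>2)"

definition perturbation_set :: "nat \<Rightarrow> (nat \<Rightarrow> real^'m \<Rightarrow> real) \<Rightarrow> (real^'m) set" where
  "perturbation_set m\<^sub>d hD = {d. \<forall>i\<in>{1..m\<^sub>d}. hD i d \<le> 0}"

definition constraint_set :: "nat \<Rightarrow> (nat \<Rightarrow> real^'n \<Rightarrow> real) \<Rightarrow> (real^'n) set" where
  "constraint_set n\<^sub>X hX = {x. \<forall>i\<in>{1..n\<^sub>X}. hX i x < 1}"

definition policies :: "'d set \<Rightarrow> (nat \<Rightarrow> 'd) set" where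
  "policies D = {\<pi>. \<forall>k. \<pi> k \<in> D}"

primrec traj :: "('x \<times> 'd \<Rightarrow> 'x) \<Rightarrow> 'x \<Rightarrow> (nat \<Rightarrow> 'd) \<Rightarrow> nat \<Rightarrow> 'x" where
  "traj f x0 \<pi> 0 = x0"
| "traj f x0 \<pi> (Suc k) = f (traj f x0 \<pi> k, \<pi> k)"

definition unif_loc_exp_stable ::
  "((real^'n) \<times> (real^'m) \<Rightarrow> real^'n) \<Rightarrow> (real^'m) set \<Rightarrow> (real^'n) set \<Rightarrow> bool" where
  "unif_loc_exp_stable f D X \<longleftrightarrow>
     (\<exists>M r lam. M > 0 \<and> r > 0 \<and> 0 < lam \<and> lam < 1 \<and> sqball r \<subseteq> X \<and>
        (\<forall>x0\<in>sqball r. \<forall>\<pi>\<in>policies D. \<forall>k. norm (traj f x0 \<pi> k) \<le> lam ^ k * M * norm x0))"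

definition max_rroa ::
  "((real^'n) \<times> (real^'m) \<Rightarrow> real^'n) \<Rightarrow> (real^'m) set \<Rightarrow> (real^'n) set \<Rightarrow> (real^'n) set" where
  "max_rroa f D X = {x0. (\<forall>k. \<forall>\<pi>\<in>policies D. traj f x0 \<pi> k \<in> X) \<and>
                         (\<forall>\<pi>\<in>policies D. traj f x0 \<pi> \<longlonglongrightarrow> 0)}"

definition robust_roa ::
  "((real^'n) \<times> (real^'m) \<Rightarrow> real^'n) \<Rightarrow> (real^'m) set \<Rightarrow> (real^'n) set \<Rightarrow> (real^'n) set \<Rightarrow> bool" where
  "robust_roa f D X S \<longleftrightarrow> S \<subseteq> max_rroa f D X"

definition Omega ::
  "((real^'n) \<times> (real^'m) \<Rightarrow> real^'n) \<Rightarrow> (real^'m) set \<Rightarrow> (real^'n) set \<Rightarrow> (real^'n) set" where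
  "Omega f D X = {x. \<exists>x0\<in>X. \<exists>d\<in>D. x = f (x0, d)} \<union> X"

definition pos_trunc :: "real \<Rightarrow> real" where
  "pos_trunc t = (if t \<ge> 0 then t else 0)"

(* Inf and Min are taken in the reals, so they are meaningful only for nonempty D (with the family
   bounded below) and n\<^sub>X \<ge> 1. *)
definition bellman_solution ::
  "((real^'n) \<times> (real^'m) \<Rightarrow> real^'n) \<Rightarrow> (real^'m) set \<Rightarrow> nat \<Rightarrow> (nat \<Rightarrow> real^'n \<Rightarrow> real) \<Rightarrow>
   (real^'n \<Rightarrow> real) \<Rightarrow> (real^'n \<Rightarrow> real) \<Rightarrow> bool" where
  "bellman_solution f D n\<^sub>X hX g v \<longleftrightarrow>
     (\<forall>x. min (INF d\<in>D. v x - v (f (x, d)) - g x * (1 - v x))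
              (v x - 1 + Min ((\<lambda>j. pos_trunc (1 - hX j x)) ` {1..n\<^sub>X})) = 0) \<and>
     v 0 = 0"

definition sos_program_solution ::
  "((real^'n) \<times> (real^'m) \<Rightarrow> real^'n) \<Rightarrow> nat \<Rightarrow> (nat \<Rightarrow> real^'m \<Rightarrow> real) \<Rightarrow>
   nat \<Rightarrow> (nat \<Rightarrow> real^'n \<Rightarrow> real) \<Rightarrow> (real^'n \<Rightarrow> real) \<Rightarrow> (real^'n \<Rightarrow> real) \<Rightarrow> real \<Rightarrow> nat \<Rightarrow>
   (real^'n \<Rightarrow> real) \<Rightarrow>
   ((real^'n) \<times> (real^'m) \<Rightarrow> real) \<Rightarrow> ((real^'n) \<times> (real^'m) \<Rightarrow> real) \<Rightarrow> ((real^'n) \<times> (real^'m) \<Rightarrow> real) \<Rightarrow>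
   (nat \<Rightarrow> (real^'n) \<times> (real^'m) \<Rightarrow> real) \<Rightarrow>
   (nat \<Rightarrow> real^'n \<Rightarrow> real) \<Rightarrow> (nat \<Rightarrow> real^'n \<Rightarrow> real) \<Rightarrow> (nat \<Rightarrow> real^'n \<Rightarrow> real) \<Rightarrow>
   (nat \<Rightarrow> real^'n \<Rightarrow> real) \<Rightarrow> (nat \<Rightarrow> real^'n \<Rightarrow> real) \<Rightarrow>
   (nat \<Rightarrow> nat \<Rightarrow> real^'n \<Rightarrow> real) \<Rightarrow> bool" where
  "sos_program_solution f m\<^sub>d hD n\<^sub>X hX g hinf R k u s0 s1 s2 s3 s4 s5 s6 s7 s8 s9 \<longleftrightarrow>
     u \<in> polys_upto k \<and>
     sos s0 \<and> sos s1 \<and> sos s2 \<and> (\<forall>i\<in>{1..m\<^sub>d}. sos (s3 i)) \<and>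
     (\<forall>j\<in>{1..n\<^sub>X}. sos (s4 j) \<and> sos (s5 j) \<and> sos (s6 j) \<and> sos (s7 j) \<and> sos (s8 j) \<and>
        (\<forall>l\<in>{1..n\<^sub>X}. sos (s9 l j))) \<and>
     (\<forall>x d. u x - u (f (x, d)) - g x * (1 - u x) =
        s0 (x, d) + s1 (x, d) * (R - h0 x) + s2 (x, d) * (hinf x - 1)
        - (\<Sum>i=1..m\<^sub>d. s3 i (x, d) * hD i d)) \<and>
     (\<forall>j\<in>{1..n\<^sub>X}. \<forall>x. u x - 1 = s4 j x + s5 j x * (R - h0 x) + s6 j x * (hX j x - 1)) \<and>
     (\<forall>j\<in>{1..n\<^sub>X}. \<forall>x. u x - hX j x =
        s7 j x + s8 j x * (R - h0 x) + (\<Sum>l=1..n\<^sub>X. s9 l j x * (1 - hX l x)))"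

end

theory Submission
  imports Defs
begin

text \<open>
  The heart of the matter is that every continuous solution \<open>v\<close> of the Bellman equation with values in
  \<open>[0,1]\<close> satisfies \<open>{x. v x < 1} = max_rroa f D X\<close>; in particular the maximal region is open and
  equals its interior.

  From left to right: the second argument of the minimum forces \<open>v \<ge> 1\<close> outside \<open>X\<close>, and the first one
  says that \<open>w = 1 - v\<close> grows at least by the factor \<open>1 + g\<close> along every trajectory.  A trajectory that
  starts with \<open>w > 0\<close> therefore stays in \<open>{w > 0} \<subseteq> X\<close>, and since \<open>w \<le> 1\<close> the values of \<open>g\<close> along it
  are summable.  As \<open>X\<close> is bounded and \<open>g\<close> vanishes only at the origin, the trajectory converges to the
  origin (lemmas \<open>sublevel_growth\<close>, \<open>tendsto_unique_zero\<close> and \<open>sublevel_subset_max_rroa\<close>).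

  From right to left: at a point of \<open>X\<close> with \<open>v = 1\<close> the second argument is positive, so the infimum is
  zero; by compactness of \<open>D\<close> it is attained, and some perturbation leads to a point where again
  \<open>v = 1\<close>.  Such worst choices, made forever, form a policy along which \<open>v\<close> stays equal to \<open>1\<close>.  Its
  trajectory cannot converge to the origin, where the continuous \<open>v\<close> is zero (lemma
  \<open>max_rroa_subset_sublevel\<close>).

  Given this identity, \<open>u i \<ge> v\<close> on the ball yields the inclusion.  For the measures, note that the
  region \<open>{x. v x < 1}\<close> lies in \<open>X\<close>, hence in the ball, where \<open>u i\<close> converges to \<open>v\<close>; so each single
  point of it satisfies \<open>u i x < 1\<close> from some \<open>i\<close> on.  Since the region has finite measure, continuity of
  the measure from above makes the differences vanish (lemma
  \<open>emeasure_tendsto_zero_of_eventually_notin\<close>).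
\<close>

section \<open>Compactness and measure\<close>

text \<open>
  Outside any ball around \<open>a\<close>, the function \<open>g\<close> has a positive minimum on the compact closure of the
  bounded set, and \<open>g (x k)\<close> eventually drops below it.
\<close>

lemma tendsto_unique_zero:
  fixes g :: "'a::heine_borel \<Rightarrow> real"
  assumes bdd: "bounded S" and xS: "\<And>k. x k \<in> S"
    and cont: "continuous_on UNIV g" and pos: "\<And>y. y \<noteq> a \<Longrightarrow> g y > 0"
    and lim: "(\<lambda>k. g (x k)) \<longlonglongrightarrow> 0"
  shows "x \<longlonglongrightarrow> a"
proof (rule tendstoI)
  fix e :: real assume "e > 0"
  define K where "K = closure S - ball a e"
  have K: "compact K"
    unfolding K_def using bdd by (intro compact_diff) (auto simp: compact_closure)
  show "eventually (\<lambda>k. dist (x k) a < e) sequentially"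
  proof (cases "K = {}")
    case True
    then have "x k \<in> ball a e" for k
      using xS closure_subset[of S] unfolding K_def by blast
    then show ?thesis by (simp add: dist_commute)
  next
    case False
    obtain y where y: "y \<in> K" "\<And>z. z \<in> K \<Longrightarrow> g y \<le> g z"
      using continuous_attains_inf[OF K False continuous_on_subset[OF cont subset_UNIV]] by blast
    have "y \<noteq> a" using y(1) \<open>e > 0\<close> by (auto simp: K_def)
    then have "eventually (\<lambda>k. g (x k) < g y) sequentially"
      using order_tendstoD(2)[OF lim] pos by blast
    then show ?thesis
    proof (rule eventually_mono)
      fix k assume "g (x k) < g y"
      then have "x k \<notin> K" using y(2) by force
      then show "dist (x k) a < e"
        using xS[of k] closure_subset[of S] by (auto simp: K_def dist_commute)
    qed
  qed
qed

text \<open>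
  The unions of the tails decrease to the empty set, so continuity from above applies to them.
\<close>

lemma emeasure_tendsto_zero_of_eventually_notin:
  assumes meas: "\<And>i::nat. E i \<in> sets M" and sub: "\<And>i. E i \<subseteq> S"
    and S: "S \<in> sets M" "emeasure M S \<noteq> \<infinity>"
    and out: "\<And>x. x \<in> S \<Longrightarrow> eventually (\<lambda>i. x \<notin> E i) sequentially"
  shows "(\<lambda>i. emeasure M (E i)) \<longlonglongrightarrow> 0"
proof -
  define F where "F n = (\<Union>i\<in>{n..}. E i)" for n
  have F: "F n \<in> sets M" for n
    unfolding F_def using meas by (intro sets.countable_UN'') auto
  have "decseq F"
    unfolding F_def decseq_def by fastforce
  have "F n \<subseteq> S" for n
    unfolding F_def using sub by blast
  then have fin: "emeasure M (F n) \<noteq> \<infinity>" for n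
    using emeasure_mono[of "F n" S M] S by (metis infinity_ennreal_def top.extremum_unique)
  have "(\<Inter>n. F n) = {}"
  proof (rule ccontr)
    assume "(\<Inter>n. F n) \<noteq> {}"
    then obtain x where x: "\<And>n. x \<in> F n" by blast
    then have "x \<in> S" using \<open>F 0 \<subseteq> S\<close> by blast
    then obtain n where "\<forall>i\<ge>n. x \<notin> E i"
      using out by (auto simp: eventually_sequentially)
    with x[of n] show False by (auto simp: F_def)
  qed
  then have "(\<lambda>n. emeasure M (F n)) \<longlonglongrightarrow> 0"
    using Lim_emeasure_decseq[of F M] F \<open>decseq F\<close> fin by (metis emeasure_empty image_subsetI)
  moreover have "emeasure M (E n) \<le> emeasure M (F n)" for n
    using F by (intro emeasure_mono) (auto simp: F_def)
  ultimately show ?thesis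
    by (simp add: tendsto_sandwich[of "\<lambda>_. 0" _ _ "\<lambda>n. emeasure M (F n)"])
qed

section \<open>The Bellman equation\<close>

lemma bellman_decrease:
  fixes f :: "(real^'n) \<times> (real^'m) \<Rightarrow> real^'n"
  assumes bell: "bellman_solution f D n\<^sub>X hX g v" and v1: "\<And>x. v x \<le> 1" and d: "d \<in> D"
  shows "v (f (x, d)) \<le> v x - g x * (1 - v x)"
proof -
  define c where "c d = v x - v (f (x, d)) - g x * (1 - v x)" for d
  have "0 = min (INF d\<in>D. c d) (v x - 1 + Min ((\<lambda>j. pos_trunc (1 - hX j x)) ` {1..n\<^sub>X}))"
    using bell by (simp add: bellman_solution_def c_def)
  then have "0 \<le> (INF d\<in>D. c d)" by linarith
  also have "\<dots> \<le> c d"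
  proof (rule cINF_lower[OF _ d])
    \<comment> \<open>In the reals an infimum is a lower bound only of a family that is bounded below; here this is \<open>v \<le> 1\<close>.\<close>
    show "bdd_below (c ` D)"
      by (rule bdd_belowI[of _ "v x - 1 - g x * (1 - v x)"]) (auto simp: c_def v1)
  qed
  finally show ?thesis by (simp add: c_def)
qed

lemma bellman_sublevel_subset:
  fixes f :: "(real^'n) \<times> (real^'m) \<Rightarrow> real^'n"
  assumes bell: "bellman_solution f D n\<^sub>X hX g v" and v: "v x < 1"
  shows "x \<in> constraint_set n\<^sub>X hX"
proof -
  have "0 \<le> v x - 1 + Min ((\<lambda>j. pos_trunc (1 - hX j x)) ` {1..n\<^sub>X})"
    using bell unfolding bellman_solution_def by (metis min.cobounded2)
  then have m: "Min ((\<lambda>j. pos_trunc (1 - hX j x)) ` {1..n\<^sub>X}) > 0"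
    using v by linarith
  have "hX j x < 1" if j: "j \<in> {1..n\<^sub>X}" for j
  proof -
    have "pos_trunc (1 - hX j x) > 0"
      using m Min_le[of "(\<lambda>j. pos_trunc (1 - hX j x)) ` {1..n\<^sub>X}" "pos_trunc (1 - hX j x)"] j
      by force
    then show ?thesis by (auto simp: pos_trunc_def split: if_splits)
  qed
  then show ?thesis by (simp add: constraint_set_def)
qed

text \<open>
  Inside the constraint set the obstacle term is positive, so only the infimum can make the minimum
  zero; compactness of \<open>D\<close> turns it into an actual perturbation that keeps the value at \<open>1\<close>.
\<close>

lemma bellman_worst_perturbation:
  fixes f :: "(real^'n) \<times> (real^'m) \<Rightarrow> real^'n"
  assumes bell: "bellman_solution f D n\<^sub>X hX g v" and n: "n\<^sub>X \<ge> 1"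
    and D: "compact D" "D \<noteq> {}"
    and f: "continuous_on UNIV f" and v: "continuous_on UNIV v"
    and x: "x \<in> constraint_set n\<^sub>X hX" "v x = 1"
  shows "\<exists>d\<in>D. v (f (x, d)) = 1"
proof -
  have "pos_trunc (1 - hX j x) > 0" if "j \<in> {1..n\<^sub>X}" for j
  proof -
    have "hX j x < 1" using x(1) that unfolding constraint_set_def by blast
    then show ?thesis by (simp add: pos_trunc_def)
  qed
  then have m: "Min ((\<lambda>j. pos_trunc (1 - hX j x)) ` {1..n\<^sub>X}) > 0"
    using n by (subst Min_gr_iff) auto
  have "min (INF d\<in>D. 1 - v (f (x, d))) (Min ((\<lambda>j. pos_trunc (1 - hX j x)) ` {1..n\<^sub>X})) = 0"
    using bell x(2) by (auto simp: bellman_solution_def dest: spec[of _ x])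
  with m have inf0: "(INF d\<in>D. 1 - v (f (x, d))) = 0" by linarith
  have "continuous_on D (\<lambda>d. 1 - v (f (x, d)))"
    by (intro continuous_intros continuous_on_compose2[OF v] continuous_on_compose2[OF f]) auto
  then obtain d where d: "d \<in> D" "\<And>e. e \<in> D \<Longrightarrow> 1 - v (f (x, d)) \<le> 1 - v (f (x, e))"
    using continuous_attains_inf[OF D] by blast
  have "(INF d\<in>D. 1 - v (f (x, d))) = 1 - v (f (x, d))"
    using d by (intro cInf_eq_minimum) auto
  with inf0 d(1) show ?thesis by auto
qed

section \<open>The sublevel set of the Bellman solution is the maximal region of attraction\<close>

text \<open>
  The decrease inequality reads \<open>1 - v (f (x, d)) \<ge> (1 + g x) * (1 - v x)\<close>; expanding the product of the
  factors \<open>1 + g\<close> only to first order gives a bound on the partial sums of \<open>g\<close>.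
\<close>

lemma sublevel_growth:
  fixes f :: "(real^'n) \<times> (real^'m) \<Rightarrow> real^'n"
    and v g :: "real^'n \<Rightarrow> real"
  assumes dec: "\<And>x d. d \<in> D \<Longrightarrow> v (f (x, d)) \<le> v x - g x * (1 - v x)"
    and g: "\<And>x. g x \<ge> 0" and pol: "\<pi> \<in> policies D" and x: "v x < 1"
  shows "1 - v (traj f x \<pi> k) \<ge> (1 - v x) * (1 + (\<Sum>i<k. g (traj f x \<pi> i)))"
proof (induction k)
  case 0
  show ?case by simp
next
  case (Suc k)
  let ?y = "traj f x \<pi> k"
  have "1 - v x \<le> (1 - v x) * (1 + (\<Sum>i<k. g (traj f x \<pi> i)))"
    using x mult_nonneg_nonneg[OF _ sum_nonneg[OF g], of "1 - v x"] by (simp add: distrib_left)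
  with Suc have "1 - v x \<le> 1 - v ?y" by linarith
  then have "g ?y * (1 - v x) \<le> g ?y * (1 - v ?y)"
    by (intro mult_left_mono g)
  moreover have "v (f (?y, \<pi> k)) \<le> v ?y - g ?y * (1 - v ?y)"
    using dec pol by (auto simp: policies_def)
  ultimately show ?case
    using Suc by (simp add: algebra_simps)
qed

lemma sublevel_subset_max_rroa:
  fixes f :: "(real^'n) \<times> (real^'m) \<Rightarrow> real^'n"
  assumes bell: "bellman_solution f D n\<^sub>X hX g v" and X: "bounded (constraint_set n\<^sub>X hX)"
    and v: "\<And>x. 0 \<le> v x" "\<And>x. v x \<le> 1"
    and g: "continuous_on UNIV g" "\<And>x. g x \<ge> 0" "\<And>x. g x = 0 \<longleftrightarrow> x = 0"
  shows "{x. v x < 1} \<subseteq> max_rroa f D (constraint_set n\<^sub>X hX)"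
proof
  fix x assume "x \<in> {x. v x < 1}"
  then have x: "v x < 1" by simp
  have inX: "traj f x \<pi> k \<in> constraint_set n\<^sub>X hX" and lim: "traj f x \<pi> \<longlonglongrightarrow> 0"
    if pol: "\<pi> \<in> policies D" for \<pi> k
  proof -
    let ?s = "\<lambda>k. \<Sum>i<k. g (traj f x \<pi> i)"
    have growth: "1 - v (traj f x \<pi> k) \<ge> (1 - v x) * (1 + ?s k)" for k
      using sublevel_growth[OF bellman_decrease[OF bell v(2)] g(2) pol x] .
    have s0: "?s k \<ge> 0" for k by (intro sum_nonneg g)
    have "(1 - v x) * (1 + ?s k) > 0" for k
      using x s0[of k] by (intro mult_pos_pos) auto
    then have "v (traj f x \<pi> k) < 1" for k using growth[of k] by (smt (verit))
    then have stay: "traj f x \<pi> k \<in> constraint_set n\<^sub>X hX" for k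
      by (intro bellman_sublevel_subset[OF bell])
    then show "traj f x \<pi> k \<in> constraint_set n\<^sub>X hX" .
    have "?s k \<le> 1 / (1 - v x)" for k
    proof -
      have "(1 - v x) * (1 + ?s k) \<le> 1"
        using growth[of k] v(1)[of "traj f x \<pi> k"] by linarith
      then show ?thesis using x by (simp add: field_simps)
    qed
    then have "summable (\<lambda>k. g (traj f x \<pi> k))"
      using g(2) by (intro summableI_nonneg_bounded) auto
    then have "(\<lambda>k. g (traj f x \<pi> k)) \<longlonglongrightarrow> 0" by (rule summable_LIMSEQ_zero)
    then show "traj f x \<pi> \<longlonglongrightarrow> 0"
      using g by (intro tendsto_unique_zero[OF X stay]) (auto simp: less_le)
  qed
  show "x \<in> max_rroa f D (constraint_set n\<^sub>X hX)"
    using inX lim by (auto simp: max_rroa_def)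
qed

lemma max_rroa_subset_sublevel:
  fixes f :: "(real^'n) \<times> (real^'m) \<Rightarrow> real^'n"
  assumes bell: "bellman_solution f D n\<^sub>X hX g v" and n: "n\<^sub>X \<ge> 1"
    and D: "compact D" "D \<noteq> {}"
    and f: "continuous_on UNIV f" and v: "continuous_on UNIV v" "\<And>x. v x \<le> 1"
  shows "max_rroa f D (constraint_set n\<^sub>X hX) \<subseteq> {x. v x < 1}"
proof (rule subsetI, rule ccontr)
  fix x assume x: "x \<in> max_rroa f D (constraint_set n\<^sub>X hX)" and "x \<notin> {x. v x < 1}"
  with v(2)[of x] have vx: "v x = 1" by simp
  \<comment> \<open>A feedback: outside \<open>{y \<in> X. v y = 1}\<close> it may be any perturbation, so that it always yields a policy.\<close>
  have "\<exists>d\<in>D. y \<in> constraint_set n\<^sub>X hX \<and> v y = 1 \<longrightarrow> v (f (y, d)) = 1" for y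
    using bellman_worst_perturbation[OF bell n D f v(1), of y] D(2) by blast
  then obtain w where w: "\<And>y. w y \<in> D"
    "\<And>y. y \<in> constraint_set n\<^sub>X hX \<Longrightarrow> v y = 1 \<Longrightarrow> v (f (y, w y)) = 1"
    by metis
  define z where "z k = ((\<lambda>y. f (y, w y)) ^^ k) x" for k
  define \<pi> where "\<pi> k = w (z k)" for k
  have pol: "\<pi> \<in> policies D" by (simp add: policies_def \<pi>_def w)
  have z: "traj f x \<pi> k = z k" for k
    by (induction k) (auto simp: z_def \<pi>_def)
  have zX: "z k \<in> constraint_set n\<^sub>X hX" for k
    using x pol unfolding max_rroa_def z[symmetric] by blast
  have one: "v (z k) = 1" for k
  proof (induction k)
    case 0
    show ?case by (simp add: z_def vx)
  next
    case (Suc k)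
    then show ?case using w(2)[OF zX[of k]] by (simp add: z_def)
  qed
  have "traj f x \<pi> \<longlonglongrightarrow> 0" using x pol by (simp add: max_rroa_def)
  then have "z \<longlonglongrightarrow> 0" by (simp add: z[abs_def])
  moreover have "isCont v 0" using v(1) by (simp add: continuous_on_eq_continuous_at)
  ultimately have "(\<lambda>k. v (z k)) \<longlonglongrightarrow> v 0" by (rule isCont_tendsto_compose[rotated])
  then have "v 0 = 1" by (simp add: one LIMSEQ_const_iff)
  then show False using bell by (simp add: bellman_solution_def)
qed

section \<open>Convergence of the approximating regions\<close>

lemma polys_upto_continuous:
  fixes p :: "real^'n \<Rightarrow> real"
  assumes "p \<in> polys_upto k"
  shows "continuous_on UNIV p"
proof -
  obtain c where "p = (\<lambda>x. \<Sum>\<alpha> | (\<Sum>i\<in>UNIV. \<alpha> i) \<le> k. c \<alpha> * (\<Prod>i\<in>UNIV. x $ i ^ \<alpha> i))"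
    using assms by (auto simp: polys_upto_def fun_eq_iff)
  then show ?thesis by (auto intro!: continuous_intros)
qed

lemma closed_sqball: "closed (sqball r :: (real^'n) set)"
  unfolding sqball_def by (intro closed_Collect_le continuous_intros)

theorem theorem3:
  fixes f :: "(real^'n) \<times> (real^'m) \<Rightarrow> real^'n"
    and hD :: "nat \<Rightarrow> real^'m \<Rightarrow> real" and m\<^sub>d :: nat and D :: "(real^'m) set"
    and hX :: "nat \<Rightarrow> real^'n \<Rightarrow> real" and n\<^sub>X :: nat and X :: "(real^'n) set"
    and g v hinf :: "real^'n \<Rightarrow> real"
    and Xinf :: "(real^'n) set" and R :: real
    and k :: "nat \<Rightarrow> nat" and u :: "nat \<Rightarrow> real^'n \<Rightarrow> real"
  assumes f_poly: "\<forall>i. real_polynomial_function (\<lambda>z. f z $ i)"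
    and hD_poly: "\<forall>i\<in>{1..m\<^sub>d}. real_polynomial_function (hD i)"
    and D_eq: "D = perturbation_set m\<^sub>d hD"
    and D_compact: "compact D"
    and D_nonempty: "D \<noteq> {}"
    and f_zero: "\<forall>d\<in>D. f (0, d) = 0"
    and hX_poly: "\<forall>i\<in>{1..n\<^sub>X}. real_polynomial_function (hX i)"
    and hX_pos: "\<forall>i\<in>{1..n\<^sub>X}. \<forall>x. x \<noteq> 0 \<longrightarrow> hX i x > 0"
    and hX_zero: "\<forall>i\<in>{1..n\<^sub>X}. hX i 0 = 0"
    and X_eq: "X = constraint_set n\<^sub>X hX"
    and X_bounded: "bounded X"
    and X_open: "open X"
    and g_poly: "real_polynomial_function g"
    and g_nonneg: "\<forall>x. g x \<ge> 0"
    and g_zero_iff: "\<forall>x. g x = 0 \<longleftrightarrow> x = 0"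
    and v_range: "\<forall>x. 0 \<le> v x \<and> v x \<le> 1"
    and v_bounded: "bounded (range v)"
    and v_continuous: "continuous_on UNIV v"
    and v_bellman: "bellman_solution f D n\<^sub>X hX g v"
    and stable: "unif_loc_exp_stable f D X"
    and R_pos: "R > 0"
    and Omega_subset: "Omega f D X \<subseteq> sqball R"
    and hinf_poly: "real_polynomial_function hinf"
    and Xinf_eq: "Xinf = {x. hinf x < 1}"
    and Xinf_rroa: "robust_roa f D X Xinf"
    and zero_Xinf: "0 \<in> interior Xinf"
    and hD_ball: "\<exists>i\<in>{1..m\<^sub>d}. \<exists>R\<^sub>D\<ge>0. \<forall>d. hD i d = (norm d)\<^sup>2 - R\<^sub>D"
    and u_solution: "\<forall>i. \<exists>s0 s1 s2 s3 s4 s5 s6 s7 s8 s9.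
          sos_program_solution f m\<^sub>d hD n\<^sub>X hX g hinf R (k i) (u i) s0 s1 s2 s3 s4 s5 s6 s7 s8 s9"
    and u_above: "\<forall>i. \<forall>x\<in>sqball R. u i x \<ge> v x"
    and u_uniform: "uniform_limit (sqball R) u v sequentially"
  shows "(\<forall>i. {x \<in> sqball R. u i x < 1} \<subseteq> interior (max_rroa f D X)) \<and>
         (\<lambda>i. emeasure lebesgue (interior (max_rroa f D X) - {x \<in> sqball R. u i x < 1}))
           \<longlonglongrightarrow> 0"
proof -
  have n1: "n\<^sub>X \<ge> 1"
  proof (rule ccontr)
    \<comment> \<open>Without constraints \<open>X\<close> would be the whole space, which is unbounded.\<close>
    assume "\<not> n\<^sub>X \<ge> 1"
    then have "X = UNIV" by (simp add: X_eq constraint_set_def)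
    then show False using X_bounded not_bounded_UNIV by metis
  qed
  have "continuous_on UNIV (\<lambda>z. f z $ i)" for i
    using f_poly by (intro continuous_at_imp_continuous_on ballI continuous_real_polymonial_function) simp
  then have "continuous_on UNIV (\<lambda>z. \<chi> i. f z $ i)"
    by (rule continuous_on_vec_lambda)
  then have f_cont: "continuous_on UNIV f" by simp
  have g_cont: "continuous_on UNIV g"
    using g_poly by (intro continuous_at_imp_continuous_on ballI continuous_real_polymonial_function)
  define W where "W = {x. v x < 1}"
  have W: "max_rroa f D X = W"
  proof (rule equalityI)
    show "max_rroa f D X \<subseteq> W"
      unfolding W_def X_eq
      using v_range by (intro max_rroa_subset_sublevel[OF v_bellman n1 D_compact D_nonempty f_cont v_continuous]) simp
    show "W \<subseteq> max_rroa f D X"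
      unfolding W_def X_eq
      using v_range g_nonneg g_zero_iff
      by (intro sublevel_subset_max_rroa[OF v_bellman X_bounded[unfolded X_eq] _ _ g_cont]) simp_all
  qed
  have "open W"
    unfolding W_def by (intro open_Collect_less v_continuous continuous_intros)
  then have int_W: "interior (max_rroa f D X) = W" by (simp add: W interior_open)
  have "W \<subseteq> X"
    using bellman_sublevel_subset[OF v_bellman] by (auto simp: W_def X_eq)
  then have W_ball: "W \<subseteq> sqball R" and W_bounded: "bounded W"
    using Omega_subset X_bounded bounded_subset by (auto simp: Omega_def)
  have incl: "{x \<in> sqball R. u i x < 1} \<subseteq> W" for i
    unfolding W_def using u_above le_less_trans by blast
  have u_cont: "continuous_on UNIV (u i)" for i
    using u_solution polys_upto_continuous unfolding sos_program_solution_def by blast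
  have "(\<lambda>i. emeasure lebesgue (W - {x \<in> sqball R. u i x < 1})) \<longlonglongrightarrow> 0"
  proof (rule emeasure_tendsto_zero_of_eventually_notin)
    show W_sets: "W \<in> sets lebesgue"
      using \<open>open W\<close> by auto
    show "emeasure lebesgue W \<noteq> \<infinity>"
      using fmeasurableD2[OF bounded_set_imp_lmeasurable[OF W_bounded W_sets]] by simp
    show "W - {x \<in> sqball R. u i x < 1} \<in> sets lebesgue" for i
    proof -
      have "open {x. u i x < 1}"
        by (intro open_Collect_less u_cont continuous_intros)
      then have "sqball R \<inter> {x. u i x < 1} \<in> sets lebesgue"
        using borel_closed[OF closed_sqball, of R] by (intro sets.Int) auto
      then have "W - sqball R \<inter> {x. u i x < 1} \<in> sets lebesgue"
        using W_sets by (rule sets.Diff[rotated])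
      also have "sqball R \<inter> {x. u i x < 1} = {x \<in> sqball R. u i x < 1}" by blast
      finally show ?thesis .
    qed
    show "eventually (\<lambda>i. x \<notin> W - {x \<in> sqball R. u i x < 1}) sequentially" if "x \<in> W" for x
    proof -
      have x: "x \<in> sqball R" "v x < 1" using that W_ball by (auto simp: W_def)
      then have "(\<lambda>i. u i x) \<longlonglongrightarrow> v x"
        using tendsto_uniform_limitI[OF u_uniform] by blast
      then have "eventually (\<lambda>i. u i x < 1) sequentially"
        using x(2) by (rule order_tendstoD(2))
      then show ?thesis by (rule eventually_mono) (use x(1) in auto)
    qed
  qed auto
  with incl show ?thesis by (simp add: int_W)
qed

end
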